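(* Let $\beta=\{\beta_\alpha:\alpha\in\mathbb N^d\}$ be a multisequence of positive real numbers and let $\mathscr M_z$ be bounded on $\mathcal H^2(\beta)$. Then $\mathscr M_z$ is weakly $\mathcal U(d)$-homogeneous if and only if $C_u$ is a bounded operator on $\mathcal H^2(\beta)$ for all $u\in\mathcal U(d)$.
   Context: $\mathbb N$ is the set of non-negative integers. For a multisequence $\beta$ of positive reals, $\mathcal H^2(\beta)$ is the Hilbert space of formal power series $f=\sum_{\alpha\in\mathbb N^d}a_\alpha z^\alpha$, $a_\alpha\in\mathbb C$, in $z=(z_1,\ldots,z_d)$ with $\|f\|^2=\sum_\alpha|a_\alpha|^2\beta_\alpha^2<\infty$ and inner product $\langle f,g\rangle=\sum_\alpha a_\alpha\overline{b_\alpha}\beta_\alpha^2$ for $g=\sum_\alpha b_\alpha z^\alpha$. $\mathscr M_z=(\mathscr M_{z_1},\ldots,\mathscr M_{z_d})$ with $\mathscr M_{z_j}f=z_jf$. $\mathcal U(d)$ is the group of $d\times d$ complex unitary matrices; for $u=(u_{jk})\in\mathcal U(d)$, $u\cdot z$ is the usual matrix product, with $j$-th entry $\sum_k u_{jk}z_k$. $C_u$ is the densely defined linear transformation in $\mathcal H^2(\beta)$ given by $C_uf(z)=f(u\cdot z)$ (the formal power series obtained by substituting $u\cdot z$, which is well defined degree by degree); $C_u$ is a bounded operator on $\mathcal H^2(\beta)$ if it maps $\mathcal H^2(\beta)$ boundedly into itself. For a $d$-tuple $T$ of operators, $(u\cdot T)_j=\sum_{k=1}^d u_{jk}T_k$.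 A commuting $d$-tuple $T$ of bounded operators on a complex separable Hilbert space $\mathcal H$ is weakly $\mathcal U(d)$-homogeneous if for every $u\in\mathcal U(d)$ there is a bounded invertible operator $\Gamma(u)$ on $\mathcal H$ with $\Gamma(u)T_j=(u\cdot T)_j\Gamma(u)$ for $j=1,\ldots,d$. *)

theory Defs
  imports
    "HOL-Analysis.Analysis"
    "HOL-Library.Function_Algebras"
    "HOL-Library.Poly_Mapping"
begin

section \<open>Operators on a complex Hilbert space\<close>

text \<open>
  The Hilbert space of interest depends on the parameter \<open>\<beta>\<close> and so cannot be a type. A space is
  given by a carrier inside an additive group, a complex scalar multiplication and an inner product,
  linear in the first argument. The notions below refer to the values of operators on the carrier
  only, and they are meant for carriers that are Hilbert spaces; their definitions use no more than
  the vector space operations and the norm.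
\<close>

record 'a inner_space =
  carrier :: "'a set"
  scale :: "complex \<Rightarrow> 'a \<Rightarrow> 'a"
  cinner :: "'a \<Rightarrow> 'a \<Rightarrow> complex"

definition hnorm :: "'a inner_space \<Rightarrow> 'a \<Rightarrow> real" where
  "hnorm H f = sqrt (Re (cinner H f f))"

definition bounded_operator :: "'a::ab_group_add inner_space \<Rightarrow> ('a \<Rightarrow> 'a) \<Rightarrow> bool" where
  "bounded_operator H A \<longleftrightarrow>
     (\<forall>f\<in>carrier H. A f \<in> carrier H) \<and>
     (\<forall>f\<in>carrier H. \<forall>g\<in>carrier H. A (f + g) = A f + A g) \<and>
     (\<forall>c. \<forall>f\<in>carrier H. A (scale H c f) = scale H c (A f)) \<and>
     (\<exists>K. \<forall>f\<in>carrier H. hnorm H (A f) \<le> K * hnorm H f)"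

definition bounded_invertible :: "'a::ab_group_add inner_space \<Rightarrow> ('a \<Rightarrow> 'a) \<Rightarrow> bool" where
  "bounded_invertible H A \<longleftrightarrow>
     bounded_operator H A \<and>
     (\<exists>B. bounded_operator H B \<and> (\<forall>f\<in>carrier H. A (B f) = f \<and> B (A f) = f))"

definition commuting_tuple :: "'a::ab_group_add inner_space \<Rightarrow> ('d \<Rightarrow> 'a \<Rightarrow> 'a) \<Rightarrow> bool" where
  "commuting_tuple H T \<longleftrightarrow>
     (\<forall>j. bounded_operator H (T j)) \<and>
     (\<forall>j k. \<forall>f\<in>carrier H. T j (T k f) = T k (T j f))"

definition conj_transpose :: "complex ^ 'm ^ 'n \<Rightarrow> complex ^ 'n ^ 'm" where
  "conj_transpose u = (\<chi> i j. cnj (u $ j $ i))"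

definition unitary_group :: "(complex ^ 'd ^ 'd::finite) set" where
  "unitary_group = {u. conj_transpose u ** u = mat 1 \<and> u ** conj_transpose u = mat 1}"

definition act_tuple ::
    "'a::ab_group_add inner_space \<Rightarrow> complex ^ 'd ^ 'd::finite \<Rightarrow> ('d \<Rightarrow> 'a \<Rightarrow> 'a) \<Rightarrow> 'd \<Rightarrow> 'a \<Rightarrow> 'a" where
  "act_tuple H u T j f = (\<Sum>k\<in>UNIV. scale H (u $ j $ k) (T k f))"

definition weakly_homogeneous ::
    "'a::ab_group_add inner_space \<Rightarrow> ('d::finite \<Rightarrow> 'a \<Rightarrow> 'a) \<Rightarrow> bool" where
  "weakly_homogeneous H T \<longleftrightarrow>
     commuting_tuple H T \<and>
     (\<forall>u\<in>unitary_group. \<exists>\<Gamma>. bounded_invertible H \<Gamma> \<and>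
        (\<forall>j. \<forall>f\<in>carrier H. \<Gamma> (T j f) = act_tuple H u T j (\<Gamma> f)))"


section \<open>Formal power series and weighted Hardy spaces\<close>

text \<open>
  Multi-indices are finitely supported functions from the finite type \<open>'d\<close> of variables to \<open>nat\<close>
  (since \<open>'d\<close> is finite, these are all functions), and a formal power series is its family of
  coefficients. On power series, \<open>+\<close> is the pointwise sum of \<open>Function_Algebras\<close>; the pointwise
  product of that theory is not used. Multivariate polynomials are finitely supported families of
  coefficients, and their multiplication is the convolution of \<open>Poly_Mapping\<close>.
\<close>

type_synonym 'd multiindex = "'d \<Rightarrow>\<^sub>0 nat"
type_synonym 'd power_series = "'d multiindex \<Rightarrow> complex"
type_synonym 'd polynomial = "'d multiindex \<Rightarrow>\<^sub>0 complex"

definition H2 :: "('d::finite multiindex \<Rightarrow> real) \<Rightarrow> 'd power_series inner_space" where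
  "H2 \<beta> = \<lparr>
     carrier = {f. (\<lambda>\<alpha>. (cmod (f \<alpha>))\<^sup>2 * (\<beta> \<alpha>)\<^sup>2) summable_on UNIV},
     scale = (\<lambda>c f \<alpha>. c * f \<alpha>),
     cinner = (\<lambda>f g. \<Sum>\<^sub>\<infinity>\<alpha>. f \<alpha> * cnj (g \<alpha>) * (complex_of_real (\<beta> \<alpha>))\<^sup>2)\<rparr>"

definition Mz :: "'d::finite \<Rightarrow> 'd power_series \<Rightarrow> 'd power_series" where
  "Mz j f = (\<lambda>\<gamma>. if Poly_Mapping.lookup \<gamma> j = 0 then 0 else f (\<gamma> - Poly_Mapping.single j 1))"

definition mdegree :: "'d::finite multiindex \<Rightarrow> nat" where
  "mdegree \<alpha> = (\<Sum>j\<in>UNIV. Poly_Mapping.lookup \<alpha> j)"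

definition monomial_subst :: "complex ^ 'd ^ 'd::finite \<Rightarrow> 'd multiindex \<Rightarrow> 'd polynomial" where
  \<comment> \<open>the polynomial \<open>(u \<cdot> z)\<^sup>\<alpha>\<close>, the product over \<open>j\<close> of \<open>(\<Sum>k. u\<^sub>j\<^sub>k z\<^sub>k) ^ \<alpha>\<^sub>j\<close>\<close>
  "monomial_subst u \<alpha> =
     (\<Prod>j\<in>UNIV. (\<Sum>k\<in>UNIV. Poly_Mapping.single (Poly_Mapping.single k 1) (u $ j $ k))
        ^ Poly_Mapping.lookup \<alpha> j)"

text \<open>
  As \<open>(u \<cdot> z)\<^sup>\<alpha>\<close> is homogeneous of degree \<open>mdegree \<alpha>\<close>, only the finitely many \<open>\<alpha>\<close> of the same degree as
  \<open>\<gamma>\<close> contribute to the coefficient of \<open>z\<^sup>\<gamma>\<close> in \<open>f(u \<cdot> z)\<close>; see \<open>finite_mdegree\<close> and \<open>homogeneous_monomial_subst\<close>.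
  The map is defined on all formal power series; \<^term>\<open>bounded_operator (H2 \<beta>)\<close> demands that it
  sends the carrier of \<^term>\<open>H2 \<beta>\<close> to itself.
\<close>

definition Cu :: "complex ^ 'd ^ 'd::finite \<Rightarrow> 'd power_series \<Rightarrow> 'd power_series" where
  "Cu u f = (\<lambda>\<gamma>. \<Sum>\<alpha> | mdegree \<alpha> = mdegree \<gamma>.
     f \<alpha> * Poly_Mapping.lookup (monomial_subst u \<alpha>) \<gamma>)"

lemma finite_mdegree: "finite {\<alpha> :: 'd::finite multiindex. mdegree \<alpha> = n}"
proof -
  have "Poly_Mapping.lookup ` {\<alpha> :: 'd multiindex. mdegree \<alpha> = n} \<subseteq> PiE UNIV (\<lambda>_. {..n})"
    by (auto simp: mdegree_def intro: member_le_sum)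
  then have "finite (Poly_Mapping.lookup ` {\<alpha> :: 'd multiindex. mdegree \<alpha> = n})"
    by (rule finite_subset) (intro finite_PiE, auto)
  then show ?thesis
    by (rule finite_imageD) (simp add: inj_on_def poly_mapping_eqI)
qed

lemma mdegree_add: "mdegree (\<alpha> + \<beta>) = mdegree \<alpha> + mdegree \<beta>"
  by (simp add: mdegree_def lookup_add sum.distrib)

lemma mdegree_single: "mdegree (Poly_Mapping.single j n) = n"
  by (simp add: mdegree_def lookup_single when_def)

definition homogeneous :: "nat \<Rightarrow> 'd::finite polynomial \<Rightarrow> bool" where
  "homogeneous n p \<longleftrightarrow> (\<forall>\<gamma>\<in>Poly_Mapping.keys p. mdegree \<gamma> = n)"

lemma homogeneous_mult:
  "homogeneous m p \<Longrightarrow> homogeneous n q \<Longrightarrow> homogeneous (m + n) (p * q)"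
  using keys_mult[of p q] by (fastforce simp: homogeneous_def mdegree_add)

lemma homogeneous_one: "homogeneous 0 1"
  by (simp add: homogeneous_def mdegree_def)

lemma homogeneous_power: "homogeneous 1 p \<Longrightarrow> homogeneous n (p ^ n)"
  using homogeneous_mult[of 1 p] by (induction n) (auto simp: homogeneous_one)

lemma homogeneous_prod:
  "finite J \<Longrightarrow> (\<And>j. j \<in> J \<Longrightarrow> homogeneous (n j) (p j)) \<Longrightarrow> homogeneous (sum n J) (prod p J)"
  by (induction J rule: finite_induct) (auto simp: homogeneous_one homogeneous_mult)

lemma homogeneous_monomial_subst: "homogeneous (mdegree \<alpha>) (monomial_subst u \<alpha>)"
proof -
  have "homogeneous 1 (\<Sum>k\<in>UNIV. Poly_Mapping.single (Poly_Mapping.single k 1) (u $ j $ k))" for j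
    unfolding homogeneous_def
    using keys_sum[of "\<lambda>k. Poly_Mapping.single (Poly_Mapping.single k 1) (u $ j $ k)" UNIV]
    by (fastforce simp: mdegree_single split: if_splits)
  then show ?thesis
    unfolding monomial_subst_def mdegree_def
    by (intro homogeneous_prod homogeneous_power) auto
qed

end

theory Submission
  imports Defs
begin

text \<open>
  For \<open>\<Leftarrow>\<close> the intertwiner is \<open>C\<^sub>u\<close> itself: substituting \<open>u \<cdot> z\<close> into \<open>z\<^sub>j f\<close> gives
  \<open>(u \<cdot> z)\<^sub>j f(u \<cdot> z)\<close> (lemma \<open>Cu_Mz\<close>), and \<open>C\<^sub>u\<close> is inverted by \<open>C\<^bsub>u*\<^esub>\<close>, which is bounded by the
  same hypothesis (lemma \<open>Cu_Cu_cancel\<close>).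

  For \<open>\<Rightarrow>\<close> let \<open>\<Gamma>\<close> be an intertwiner for \<open>u\<close> and \<open>g = \<Gamma> 1\<close>. The relations force
  \<open>\<Gamma> p = p(u \<cdot> z) g\<close> for every polynomial \<open>p\<close>, so if \<open>p\<close> is homogeneous of degree \<open>n\<close>, then the
  degree \<open>n\<close> part of \<open>\<Gamma> p\<close> is \<open>g(0) C\<^sub>u p\<close> (lemma \<open>lowest_part_zpow\<close>). Polynomials are dense and
  evaluation at \<open>0\<close> is continuous, so \<open>g(0) = 0\<close> would make every element of the range of \<open>\<Gamma>\<close>
  vanish at \<open>0\<close>, contrary to surjectivity (lemma \<open>const_term_nonzero\<close>). Distinct monomials are
  orthogonal, whence taking the degree \<open>n\<close> part does not increase the norm, and
  \<open>\<parallel>C\<^sub>u p\<parallel> \<le> \<parallel>\<Gamma>\<parallel> \<parallel>p\<parallel> / \<bar>g(0)\<bar>\<close> with a constant independent of \<open>n\<close> (lemma \<open>degree_bound\<close>). As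
  \<open>C\<^sub>u\<close> preserves degrees, and different degrees are orthogonal, the bounds add up to one on
  the whole space (lemma \<open>bounded_operator_Cu_of_degree_bound\<close>).

  All facts about \<open>C\<^sub>u\<close> and \<open>\<Gamma>\<close> on monomials come from the recursion \<open>(u \<cdot> z)\<^bsup>\<alpha> + e\<^sub>j\<^esup> = (u \<cdot> z)\<^sub>j (u \<cdot> z)\<^sup>\<alpha>\<close>, in which multiplication by
  \<open>(u \<cdot> z)\<^sub>j\<close> is \<^term>\<open>act_tuple (H2 \<beta>) u Mz j\<close>.
\<close>

(* Otherwise the simplifier turns the 1 in unit multi-indices into Suc 0, and rules about them
   that are applied without simplification no longer match. *)
declare One_nat_def [simp del]

section \<open>Substitution into monomials\<close>

definition zpow :: "'d::finite multiindex \<Rightarrow> 'd power_series" where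
  "zpow \<alpha> = (\<lambda>\<gamma>. if \<gamma> = \<alpha> then 1 else 0)"

abbreviation unit_index :: "'d \<Rightarrow> 'd multiindex" where
  "unit_index j \<equiv> Poly_Mapping.single j 1"

lemma multiindex_diff_add_unit:
  "Poly_Mapping.lookup \<gamma> j \<noteq> 0 \<Longrightarrow> \<gamma> - unit_index j + unit_index j = \<gamma>"
  by (rule poly_mapping_eqI) (auto simp: lookup_add lookup_minus lookup_single when_def)

lemma mdegree_diff_unit:
  "Poly_Mapping.lookup \<gamma> j \<noteq> 0 \<Longrightarrow> Suc (mdegree (\<gamma> - unit_index j)) = mdegree \<gamma>"
  by (metis Suc_eq_plus1 mdegree_add mdegree_single multiindex_diff_add_unit)

lemma mdegree_eq_0_iff: "mdegree \<gamma> = 0 \<longleftrightarrow> \<gamma> = 0"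
  by (auto simp: mdegree_def intro: poly_mapping_eqI)

lemma multiindex_induct [case_names zero add_unit]:
  fixes \<alpha> :: "'d::finite multiindex"
  assumes "P 0" and "\<And>\<alpha> j. P \<alpha> \<Longrightarrow> P (\<alpha> + unit_index j)"
  shows "P \<alpha>"
proof (induction "mdegree \<alpha>" arbitrary: \<alpha>)
  case 0
  then show ?case using assms(1) by (metis mdegree_eq_0_iff)
next
  case (Suc n)
  then have "\<alpha> \<noteq> 0" using mdegree_eq_0_iff[of \<alpha>] by auto
  then obtain j where j: "Poly_Mapping.lookup \<alpha> j \<noteq> 0"
    by (metis poly_mapping_eqI lookup_zero)
  then have "P (\<alpha> - unit_index j)"
    using mdegree_diff_unit[OF j] Suc by simp
  then show ?case
    using assms(2) multiindex_diff_add_unit[OF j] by metis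
qed

lemma sum_apply: "(\<Sum>k\<in>A. F k) x = (\<Sum>k\<in>A. F k x)"
  by (induction A rule: infinite_finite_induct) auto

lemma Mz_zpow: "Mz j (zpow \<alpha>) = zpow (\<alpha> + unit_index j)"
proof
  fix \<gamma>
  show "Mz j (zpow \<alpha>) \<gamma> = zpow (\<alpha> + unit_index j) \<gamma>"
    using multiindex_diff_add_unit[of \<gamma> j]
    by (auto simp: Mz_def zpow_def lookup_add)
qed

lemma act_tuple_H2_apply:
  "act_tuple (H2 \<beta>) u T j f \<gamma> = (\<Sum>k\<in>UNIV. u $ j $ k * T k f \<gamma>)"
  by (simp add: act_tuple_def H2_def sum_apply)

text \<open>
  This links the convolution product of polynomials to the multiplication operators, and hence
  the definition of \<^const>\<open>monomial_subst\<close> to \<^const>\<open>act_tuple\<close>.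
\<close>

lemma lookup_variable_times:
  fixes p :: "'d::finite polynomial"
  shows "Poly_Mapping.lookup (Poly_Mapping.single (unit_index k) c * p) \<gamma>
    = c * Mz k (Poly_Mapping.lookup p) \<gamma>"
proof -
  have "Poly_Mapping.lookup (Poly_Mapping.single (unit_index k) c * p) \<gamma>
      = c * (\<Sum>q. (Poly_Mapping.lookup p q when \<gamma> = unit_index k + q))"
    by (simp add: lookup_mult lookup_single when_mult)
  also have "(\<Sum>q. (Poly_Mapping.lookup p q when \<gamma> = unit_index k + q))
      = Mz k (Poly_Mapping.lookup p) \<gamma>"
  proof (cases "Poly_Mapping.lookup \<gamma> k = 0")
    case True
    then have "\<gamma> \<noteq> unit_index k + q" for q
      by (auto simp: lookup_add)
    with True show ?thesis by (simp add: Mz_def)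
  next
    case False
    then have "\<gamma> = unit_index k + q \<longleftrightarrow> q = \<gamma> - unit_index k" for q
      using multiindex_diff_add_unit[OF False] by (auto simp: add.commute)
    with False show ?thesis by (simp add: Mz_def)
  qed
  finally show ?thesis .
qed

lemma monomial_subst_0: "monomial_subst u 0 = 1"
  by (simp add: monomial_subst_def)

lemma monomial_subst_add_unit:
  "monomial_subst u (\<alpha> + unit_index j) =
    (\<Sum>k\<in>UNIV. Poly_Mapping.single (unit_index k) (u $ j $ k)) * monomial_subst u \<alpha>"
proof -
  let ?L = "\<lambda>i. \<Sum>k\<in>UNIV. Poly_Mapping.single (unit_index k) (u $ i $ k)"
  have "?L i ^ Poly_Mapping.lookup (\<alpha> + unit_index j) i
      = (if i = j then ?L j else 1) * ?L i ^ Poly_Mapping.lookup \<alpha> i" for i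
    by (auto simp: lookup_add lookup_single when_def power_add mult.commute)
  then show ?thesis
    by (simp add: monomial_subst_def prod.distrib)
qed

text \<open>
  Here and below \<open>\<beta>\<close> may be chosen freely, because \<^const>\<open>act_tuple\<close> depends on the space only
  through its scalar multiplication, and that is the same for all \<open>\<beta>\<close>.
\<close>

lemma lookup_monomial_subst_add_unit:
  "Poly_Mapping.lookup (monomial_subst u (\<alpha> + unit_index j)) =
    act_tuple (H2 \<beta>) u Mz j (Poly_Mapping.lookup (monomial_subst u \<alpha>))"
  by (rule ext)
    (simp only: monomial_subst_add_unit sum_distrib_right lookup_sum lookup_variable_times
      act_tuple_H2_apply)

lemma lookup_monomial_subst_eq_0:
  "mdegree \<gamma> \<noteq> mdegree \<alpha> \<Longrightarrow> Poly_Mapping.lookup (monomial_subst u \<alpha>) \<gamma> = 0"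
  using homogeneous_monomial_subst[of \<alpha> u]
  by (auto simp: homogeneous_def in_keys_iff)

lemma Cu_zpow: "Cu u (zpow \<alpha>) = Poly_Mapping.lookup (monomial_subst u \<alpha>)"
proof
  fix \<gamma>
  have "Cu u (zpow \<alpha>) \<gamma> = (\<Sum>\<delta> | mdegree \<delta> = mdegree \<gamma>.
      if \<delta> = \<alpha> then Poly_Mapping.lookup (monomial_subst u \<alpha>) \<gamma> else 0)"
    unfolding Cu_def zpow_def by (intro sum.cong) auto
  also have "\<dots> = Poly_Mapping.lookup (monomial_subst u \<alpha>) \<gamma>"
    using lookup_monomial_subst_eq_0[of \<gamma> \<alpha> u] by (auto simp: finite_mdegree)
  finally show "Cu u (zpow \<alpha>) \<gamma> = Poly_Mapping.lookup (monomial_subst u \<alpha>) \<gamma>" .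
qed

lemma Cu_apply: "Cu u f \<gamma> = (\<Sum>\<alpha> | mdegree \<alpha> = mdegree \<gamma>. f \<alpha> * Cu u (zpow \<alpha>) \<gamma>)"
  by (subst Cu_zpow) (rule Cu_def[THEN fun_cong])

lemma Cu_zpow_0: "Cu u (zpow 0) = zpow 0"
  by (rule ext) (simp add: Cu_zpow monomial_subst_0, simp add: zpow_def lookup_one when_def)

lemma Cu_sum: "Cu u (\<lambda>\<gamma>. \<Sum>k\<in>A. c k * F k \<gamma>) \<delta> = (\<Sum>k\<in>A. c k * Cu u (F k) \<delta>)"
  unfolding Cu_def sum_distrib_left sum_distrib_right
  by (subst sum.swap) (simp add: mult.assoc)

lemma Cu_zpow_add_unit:
  "Cu u (zpow (\<alpha> + unit_index j)) = act_tuple (H2 \<beta>) u Mz j (Cu u (zpow \<alpha>))"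
  by (simp only: Cu_zpow lookup_monomial_subst_add_unit)

text \<open>
  Compare coefficients of \<open>z\<^sup>\<gamma>\<close>: the left side is a sum over the exponents of degree \<open>\<bar>\<gamma>\<bar>\<close> of the
  monomials divisible by \<open>z\<^sub>j\<close>. Dividing by \<open>z\<^sub>j\<close> turns it into a sum over the exponents of degree
  \<open>\<bar>\<gamma>\<bar> - 1\<close>, to which the recursion for monomials applies.
\<close>

lemma Cu_Mz:
  fixes f :: "'d::finite power_series"
  shows "Cu u (Mz j f) = act_tuple (H2 \<beta>) u Mz j (Cu u f)"
proof
  fix \<gamma> :: "'d multiindex"
  (* Using Suc rather than subtraction makes S empty for \<gamma> = 0, where both sides vanish. *)
  define S where "S = {\<alpha> :: 'd multiindex. Suc (mdegree \<alpha>) = mdegree \<gamma>}"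
  have shift: "Mz k (Cu u f) \<gamma> = (\<Sum>\<alpha>\<in>S. f \<alpha> * Mz k (Cu u (zpow \<alpha>)) \<gamma>)" for k
  proof (cases "Poly_Mapping.lookup \<gamma> k = 0")
    case False
    then have "S = {\<alpha>. mdegree \<alpha> = mdegree (\<gamma> - unit_index k)}"
      using mdegree_diff_unit[OF False] by (auto simp: S_def)
    with False show ?thesis
      by (simp add: Mz_def Cu_apply[of u f])
  qed (simp add: Mz_def)
  have "Cu u (Mz j f) \<gamma> = (\<Sum>\<alpha> | mdegree \<alpha> = mdegree \<gamma> \<and> Poly_Mapping.lookup \<alpha> j \<noteq> 0.
      f (\<alpha> - unit_index j) * Cu u (zpow \<alpha>) \<gamma>)"
    unfolding Cu_apply[of u "Mz j f"]
    by (rule sum.mono_neutral_cong_right) (auto simp: finite_mdegree Mz_def)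
  also have "\<dots> = (\<Sum>\<alpha>\<in>S. f \<alpha> * Cu u (zpow (\<alpha> + unit_index j)) \<gamma>)"
    by (rule sum.reindex_bij_witness[of _ "\<lambda>\<alpha>. \<alpha> + unit_index j" "\<lambda>\<alpha>. \<alpha> - unit_index j"])
      (auto simp: S_def multiindex_diff_add_unit mdegree_diff_unit mdegree_add mdegree_single lookup_add)
  also have "\<dots> = (\<Sum>k\<in>UNIV. u $ j $ k * Mz k (Cu u f) \<gamma>)"
    unfolding Cu_zpow_add_unit[of u _ j \<beta>] act_tuple_H2_apply shift sum_distrib_left
    by (subst sum.swap) (simp add: mult.left_commute)
  finally show "Cu u (Mz j f) \<gamma> = act_tuple (H2 \<beta>) u Mz j (Cu u f) \<gamma>"
    by (simp add: act_tuple_H2_apply)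
qed

lemma Cu_act_tuple:
  "Cu u (act_tuple (H2 \<beta>) v Mz j f) = act_tuple (H2 \<beta>) (v ** u) Mz j (Cu u f)"
proof
  fix \<gamma>
  have "Cu u (act_tuple (H2 \<beta>) v Mz j f) \<gamma> = (\<Sum>k\<in>UNIV. v $ j $ k * Cu u (Mz k f) \<gamma>)"
    by (simp add: act_tuple_H2_apply[abs_def] Cu_sum)
  also have "\<dots> = (\<Sum>k\<in>UNIV. \<Sum>l\<in>UNIV. v $ j $ k * u $ k $ l * Mz l (Cu u f) \<gamma>)"
    by (simp add: Cu_Mz[of u _ f \<beta>] act_tuple_H2_apply sum_distrib_left mult.assoc)
  also have "\<dots> = act_tuple (H2 \<beta>) (v ** u) Mz j (Cu u f) \<gamma>"
    by (subst sum.swap) (simp add: act_tuple_H2_apply matrix_matrix_mult_def sum_distrib_right)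
  finally show "Cu u (act_tuple (H2 \<beta>) v Mz j f) \<gamma> = act_tuple (H2 \<beta>) (v ** u) Mz j (Cu u f) \<gamma>" .
qed

lemma act_tuple_mat_1: "act_tuple (H2 \<beta>) (mat 1) T j f = T j f"
  by (rule ext) (simp add: act_tuple_H2_apply mat_def if_distrib[of "\<lambda>x. x * _"] cong: if_cong)

text \<open>
  Substituting \<open>u \<cdot> z\<close> into \<open>(v \<cdot> z)\<^sub>j\<close> gives \<open>(vu \<cdot> z)\<^sub>j\<close>, so the product of matrices appears in
  reverse order of the operators.
\<close>

lemma Cu_Cu_zpow:
  assumes "v ** u = mat 1"
  shows "Cu u (Cu v (zpow \<alpha>)) = zpow \<alpha>"
proof (induction \<alpha> rule: multiindex_induct)
  case zero
  then show ?case by (simp add: Cu_zpow_0)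
next
  case (add_unit \<alpha> j)
  then show ?case
    by (simp add: Cu_zpow_add_unit[of v \<alpha> j undefined] Cu_act_tuple assms act_tuple_mat_1 Mz_zpow)
qed

lemma Cu_cong_degree:
  "(\<And>\<alpha>. mdegree \<alpha> = mdegree \<gamma> \<Longrightarrow> f \<alpha> = g \<alpha>) \<Longrightarrow> Cu u f \<gamma> = Cu u g \<gamma>"
  unfolding Cu_def by (intro sum.cong) auto

text \<open>
  Each coefficient of the result depends on the finitely many coefficients of \<open>f\<close> of one degree
  only, which reduces the claim to monomials without any convergence argument.
\<close>

lemma Cu_Cu_cancel:
  fixes f :: "'d::finite power_series"
  assumes "v ** u = mat 1"
  shows "Cu u (Cu v f) = f"
proof
  fix \<gamma> :: "'d multiindex"
  let ?A = "{\<alpha> :: 'd multiindex. mdegree \<alpha> = mdegree \<gamma>}"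
  have "Cu u (Cu v f) \<gamma> = Cu u (\<lambda>\<delta>. \<Sum>\<alpha>\<in>?A. f \<alpha> * Cu v (zpow \<alpha>) \<delta>) \<gamma>"
    by (rule Cu_cong_degree) (simp add: Cu_apply[of v f])
  also have "\<dots> = (\<Sum>\<alpha>\<in>?A. f \<alpha> * zpow \<alpha> \<gamma>)"
    by (simp add: Cu_sum Cu_Cu_zpow[OF assms])
  also have "\<dots> = f \<gamma>"
    by (simp add: zpow_def finite_mdegree if_distrib[of "\<lambda>x. _ * x"] cong: if_cong)
  finally show "Cu u (Cu v f) \<gamma> = f \<gamma>" .
qed

section \<open>The norm of the weighted space\<close>

definition weighted_square :: "('d::finite multiindex \<Rightarrow> real) \<Rightarrow> 'd power_series \<Rightarrow> 'd multiindex \<Rightarrow> real" where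
  "weighted_square \<beta> f \<alpha> = (cmod (f \<alpha>))\<^sup>2 * (\<beta> \<alpha>)\<^sup>2"

lemma weighted_square_nonneg: "weighted_square \<beta> f \<alpha> \<ge> 0"
  by (simp add: weighted_square_def)

lemma carrier_H2: "f \<in> carrier (H2 \<beta>) \<longleftrightarrow> weighted_square \<beta> f summable_on UNIV"
  by (simp add: H2_def weighted_square_def[abs_def])

lemma scale_H2: "scale (H2 \<beta>) c f = (\<lambda>\<gamma>. c * f \<gamma>)"
  by (simp add: H2_def)

lemma cinner_H2_self:
  assumes "f \<in> carrier (H2 \<beta>)"
  shows "cinner (H2 \<beta>) f f = complex_of_real (infsum (weighted_square \<beta> f) UNIV)"
proof -
  have "f \<alpha> * cnj (f \<alpha>) * (complex_of_real (\<beta> \<alpha>))\<^sup>2 = complex_of_real (weighted_square \<beta> f \<alpha>)" for \<alpha>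
    by (simp add: weighted_square_def complex_norm_square[of "f \<alpha>", symmetric])
  moreover have "((\<lambda>\<alpha>. complex_of_real (weighted_square \<beta> f \<alpha>)) has_sum
      complex_of_real (infsum (weighted_square \<beta> f) UNIV)) UNIV"
    using assms by (simp add: has_sum_of_real_iff carrier_H2)
  ultimately show ?thesis
    by (simp add: H2_def infsumI)
qed

lemma hnorm_H2_nonneg: "f \<in> carrier (H2 \<beta>) \<Longrightarrow> hnorm (H2 \<beta>) f \<ge> 0"
  by (simp add: hnorm_def cinner_H2_self infsum_nonneg weighted_square_nonneg)

lemma hnorm_H2_square:
  "f \<in> carrier (H2 \<beta>) \<Longrightarrow> (hnorm (H2 \<beta>) f)\<^sup>2 = infsum (weighted_square \<beta> f) UNIV"
  by (simp add: hnorm_def cinner_H2_self infsum_nonneg weighted_square_nonneg)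

lemma sum_weighted_square_le:
  assumes "f \<in> carrier (H2 \<beta>)" "finite F"
  shows "(\<Sum>\<gamma>\<in>F. weighted_square \<beta> f \<gamma>) \<le> (hnorm (H2 \<beta>) f)\<^sup>2"
  using assms unfolding hnorm_H2_square[OF assms(1)]
  by (intro finite_sum_le_infsum) (auto simp: carrier_H2 weighted_square_nonneg)

definition restrict_series :: "'d::finite multiindex set \<Rightarrow> 'd power_series \<Rightarrow> 'd power_series" where
  "restrict_series F f = (\<lambda>\<gamma>. if \<gamma> \<in> F then f \<gamma> else 0)"

lemma weighted_square_restrict_series:
  "weighted_square \<beta> (restrict_series F f) = (\<lambda>\<gamma>. if \<gamma> \<in> F then weighted_square \<beta> f \<gamma> else 0)"
  by (auto simp: weighted_square_def restrict_series_def)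

lemma restrict_series_finite_carrier:
  assumes "finite F"
  shows "restrict_series F f \<in> carrier (H2 \<beta>)"
    and "(hnorm (H2 \<beta>) (restrict_series F f))\<^sup>2 = (\<Sum>\<gamma>\<in>F. weighted_square \<beta> f \<gamma>)"
proof -
  have "(weighted_square \<beta> (restrict_series F f) has_sum (\<Sum>\<gamma>\<in>F. weighted_square \<beta> f \<gamma>)) UNIV"
    using has_sum_cong_neutral[of UNIV F "weighted_square \<beta> (restrict_series F f)" "weighted_square \<beta> f"]
      assms has_sum_finite[of F "weighted_square \<beta> f"]
    by (auto simp: weighted_square_restrict_series)
  then show *: "restrict_series F f \<in> carrier (H2 \<beta>)"
    and "(hnorm (H2 \<beta>) (restrict_series F f))\<^sup>2 = (\<Sum>\<gamma>\<in>F. weighted_square \<beta> f \<gamma>)"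
    using hnorm_H2_square[of "restrict_series F f" \<beta>]
    by (auto simp: carrier_H2 has_sum_iff)
qed

text \<open>
  Density of the polynomials, phrased through the remainder, since \<open>\<Gamma>\<close> is applied to the remainder.
\<close>

lemma finite_restriction_approximates:
  assumes f: "f \<in> carrier (H2 \<beta>)" and "\<epsilon> > 0"
  obtains F where "finite F" "restrict_series (- F) f \<in> carrier (H2 \<beta>)"
    "(hnorm (H2 \<beta>) (restrict_series (- F) f))\<^sup>2 \<le> \<epsilon>"
proof -
  let ?w = "weighted_square \<beta> f"
  have summable: "?w summable_on UNIV" using f by (simp add: carrier_H2)
  obtain F where F: "finite F" "dist (sum ?w F) (infsum ?w UNIV) \<le> \<epsilon>"
    using infsum_finite_approximation[OF summable \<open>\<epsilon> > 0\<close>] by auto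
  have "(?w has_sum (infsum ?w UNIV - sum ?w F)) (- F)"
    using has_sum_Diff[OF has_sum_infsum[OF summable] has_sum_finite[OF F(1)]]
    by (simp add: Compl_eq_Diff_UNIV)
  then have "(weighted_square \<beta> (restrict_series (- F) f) has_sum (infsum ?w UNIV - sum ?w F)) UNIV"
    using has_sum_cong_neutral[of UNIV "- F" "weighted_square \<beta> (restrict_series (- F) f)" ?w]
    by (auto simp: weighted_square_restrict_series)
  then have "restrict_series (- F) f \<in> carrier (H2 \<beta>)"
      "(hnorm (H2 \<beta>) (restrict_series (- F) f))\<^sup>2 = infsum ?w UNIV - sum ?w F"
    using hnorm_H2_square[of "restrict_series (- F) f" \<beta>] by (auto simp: carrier_H2 has_sum_iff)
  with F that show thesis by (auto simp: dist_real_def)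
qed

lemma zpow_carrier: "zpow \<alpha> \<in> carrier (H2 \<beta>)"
proof -
  have "zpow \<alpha> = restrict_series {\<alpha>} (zpow \<alpha>)"
    by (auto simp: zpow_def restrict_series_def)
  then show ?thesis
    using restrict_series_finite_carrier(1) by (metis finite.emptyI finite.insertI)
qed

lemma restrict_series_split: "f = restrict_series F f + restrict_series (- F) f"
  by (rule ext) (simp add: restrict_series_def)

section \<open>From a bounded substitution to an intertwiner\<close>

lemma Mz_commute: "Mz j (Mz k f) = Mz k (Mz j f)"
proof
  fix \<gamma>
  show "Mz j (Mz k f) \<gamma> = Mz k (Mz j f) \<gamma>"
    by (auto simp: Mz_def lookup_minus lookup_single when_def diff_diff_eq add.commute)
qed

lemma bounded_Cu_imp_weakly_homogeneous:
  fixes \<beta> :: "'d::finite multiindex \<Rightarrow> real"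
  assumes Mz: "\<And>j. bounded_operator (H2 \<beta>) (Mz j)"
    and Cu: "\<And>u. u \<in> unitary_group \<Longrightarrow> bounded_operator (H2 \<beta>) (Cu u)"
  shows "weakly_homogeneous (H2 \<beta>) (Mz :: 'd \<Rightarrow> 'd power_series \<Rightarrow> 'd power_series)"
  unfolding weakly_homogeneous_def
proof (intro conjI ballI)
  show "commuting_tuple (H2 \<beta>) (Mz :: 'd \<Rightarrow> _)"
    using Mz Mz_commute unfolding commuting_tuple_def by blast
next
  fix u :: "complex ^ 'd ^ 'd"
  assume u: "u \<in> unitary_group"
  let ?v = "conj_transpose u"
  have "conj_transpose ?v = u"
    by (simp add: conj_transpose_def vec_eq_iff)
  with u have "?v \<in> unitary_group" "?v ** u = mat 1" "u ** ?v = mat 1"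
    by (auto simp: unitary_group_def)
  then have "bounded_invertible (H2 \<beta>) (Cu u)"
    unfolding bounded_invertible_def using Cu u Cu_Cu_cancel by blast
  then show "\<exists>\<Gamma>. bounded_invertible (H2 \<beta>) \<Gamma> \<and>
      (\<forall>j. \<forall>f\<in>carrier (H2 \<beta>). \<Gamma> (Mz j f) = act_tuple (H2 \<beta>) u Mz j (\<Gamma> f))"
    using Cu_Mz by blast
qed

section \<open>From an intertwiner to a bounded substitution\<close>

locale intertwiner =
  fixes \<beta> :: "'d::finite multiindex \<Rightarrow> real" and u :: "complex ^ 'd ^ 'd"
    and \<Gamma> :: "'d power_series \<Rightarrow> 'd power_series"
  assumes weights_pos: "\<beta> \<alpha> > 0"
    and invertible: "bounded_invertible (H2 \<beta>) \<Gamma>"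
    and intertwines: "f \<in> carrier (H2 \<beta>) \<Longrightarrow> \<Gamma> (Mz j f) = act_tuple (H2 \<beta>) u Mz j (\<Gamma> f)"
begin

lemma operator: "bounded_operator (H2 \<beta>) \<Gamma>"
  using invertible by (simp add: bounded_invertible_def)

lemma add: "f \<in> carrier (H2 \<beta>) \<Longrightarrow> g \<in> carrier (H2 \<beta>) \<Longrightarrow> \<Gamma> (f + g) = \<Gamma> f + \<Gamma> g"
  and mult: "f \<in> carrier (H2 \<beta>) \<Longrightarrow> \<Gamma> (\<lambda>\<gamma>. c * f \<gamma>) = (\<lambda>\<gamma>. c * \<Gamma> f \<gamma>)"
  and closed: "f \<in> carrier (H2 \<beta>) \<Longrightarrow> \<Gamma> f \<in> carrier (H2 \<beta>)"
  using operator by (auto simp: bounded_operator_def scale_H2)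

lemma bounded:
  obtains K where "\<And>f. f \<in> carrier (H2 \<beta>) \<Longrightarrow> (hnorm (H2 \<beta>) (\<Gamma> f))\<^sup>2 \<le> K\<^sup>2 * (hnorm (H2 \<beta>) f)\<^sup>2"
proof -
  obtain K where K: "\<And>f. f \<in> carrier (H2 \<beta>) \<Longrightarrow> hnorm (H2 \<beta>) (\<Gamma> f) \<le> K * hnorm (H2 \<beta>) f"
    using operator unfolding bounded_operator_def by blast
  have "(hnorm (H2 \<beta>) (\<Gamma> f))\<^sup>2 \<le> K\<^sup>2 * (hnorm (H2 \<beta>) f)\<^sup>2" if "f \<in> carrier (H2 \<beta>)" for f
    using power_mono[OF K[OF that] hnorm_H2_nonneg[OF closed[OF that]], of 2] by (simp add: power_mult_distrib)
  then show thesis by (rule that)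
qed

definition const_term :: complex where "const_term = \<Gamma> (zpow 0) 0"

text \<open>
  The coefficients of \<open>\<Gamma> z\<^sup>\<alpha> = (u \<cdot> z)\<^sup>\<alpha> \<Gamma> 1\<close> up to degree \<open>\<bar>\<alpha>\<bar>\<close>. The lower degrees, in which both
  sides vanish, are included because degree \<open>0\<close> for all \<open>\<alpha>\<close> is what shows
  \<open>const_term\<close> to be nonzero.
\<close>

lemma lowest_part_zpow:
  "mdegree \<gamma> \<le> mdegree \<alpha> \<Longrightarrow> \<Gamma> (zpow \<alpha>) \<gamma> = const_term * Cu u (zpow \<alpha>) \<gamma>"
proof (induction \<alpha> arbitrary: \<gamma> rule: multiindex_induct)
  case zero
  then have "mdegree \<gamma> = 0" by (simp add: mdegree_def)
  then have "\<gamma> = 0" by (simp only: mdegree_eq_0_iff)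
  then show ?case unfolding Cu_zpow_0 by (simp add: const_term_def zpow_def)
next
  case (add_unit \<alpha> j)
  have "Mz k (\<Gamma> (zpow \<alpha>)) \<gamma> = const_term * Mz k (Cu u (zpow \<alpha>)) \<gamma>" for k
  proof (cases "Poly_Mapping.lookup \<gamma> k = 0")
    case False
    have "mdegree (\<gamma> - unit_index k) \<le> mdegree \<alpha>"
      using mdegree_diff_unit[OF False] add_unit.prems by (simp add: mdegree_add mdegree_single)
    from add_unit.IH[OF this] show ?thesis using False by (simp add: Mz_def)
  qed (simp add: Mz_def)
  then have "act_tuple (H2 \<beta>) u Mz j (\<Gamma> (zpow \<alpha>)) \<gamma>
      = const_term * act_tuple (H2 \<beta>) u Mz j (Cu u (zpow \<alpha>)) \<gamma>"
    by (simp add: act_tuple_H2_apply sum_distrib_left mult.left_commute)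
  then show ?case
    by (simp add: Cu_zpow_add_unit[of u \<alpha> j \<beta>] intertwines[OF zpow_carrier, symmetric] Mz_zpow)
qed

lemma expand_finite:
  "finite F \<Longrightarrow> \<Gamma> (restrict_series F f) \<gamma> = (\<Sum>\<alpha>\<in>F. f \<alpha> * \<Gamma> (zpow \<alpha>) \<gamma>)"
proof (induction F rule: finite_induct)
  case empty
  have "\<Gamma> (\<lambda>_. 0 * zpow 0 \<gamma>) = (\<lambda>_. 0)"
    using mult[OF zpow_carrier, of 0] by simp
  then show ?case by (simp add: restrict_series_def)
next
  case (insert \<alpha> F)
  have "(\<lambda>\<gamma>. f \<alpha> * zpow \<alpha> \<gamma>) = restrict_series {\<alpha>} f"
    by (auto simp: zpow_def restrict_series_def)
  then have "(\<lambda>\<gamma>. f \<alpha> * zpow \<alpha> \<gamma>) \<in> carrier (H2 \<beta>)"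
    by (simp add: restrict_series_finite_carrier)
  moreover have "restrict_series (insert \<alpha> F) f = (\<lambda>\<gamma>. f \<alpha> * zpow \<alpha> \<gamma>) + restrict_series F f"
    using insert.hyps by (auto simp: zpow_def restrict_series_def)
  ultimately have "\<Gamma> (restrict_series (insert \<alpha> F) f) = (\<lambda>\<gamma>. f \<alpha> * \<Gamma> (zpow \<alpha>) \<gamma>) + \<Gamma> (restrict_series F f)"
    using insert.hyps by (simp only: add restrict_series_finite_carrier mult zpow_carrier)
  then show ?case
    using insert by simp
qed

text \<open>
  If the constant term vanished, \<open>\<Gamma>\<close> would send all polynomials to series vanishing at \<open>0\<close>. Take
  the preimage \<open>f\<close> of \<open>1\<close> and cut it off to a polynomial: the remainder is arbitrarily small, yet
  its image has constant term \<open>1\<close> and thus norm at least \<open>\<beta> 0\<close>, contrary to boundedness.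
\<close>

lemma const_term_nonzero: "const_term \<noteq> 0"
proof
  assume "const_term = 0"
  then have "\<Gamma> (zpow \<alpha>) 0 = 0" for \<alpha>
    using lowest_part_zpow[of 0 \<alpha>] by (simp add: mdegree_def)
  then have finite_0: "\<Gamma> (restrict_series F f) 0 = 0" if "finite F" for F f
    by (simp add: expand_finite[OF that])
  obtain f where f: "f \<in> carrier (H2 \<beta>)" "\<Gamma> f = zpow 0"
    using invertible zpow_carrier unfolding bounded_invertible_def bounded_operator_def by metis
  obtain K where K: "\<And>f. f \<in> carrier (H2 \<beta>) \<Longrightarrow> (hnorm (H2 \<beta>) (\<Gamma> f))\<^sup>2 \<le> K\<^sup>2 * (hnorm (H2 \<beta>) f)\<^sup>2"
    using bounded by blast
  (* chosen so that K^2 \<epsilon> < (\<beta> 0)^2; the summand 1 covers K = 0 *)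
  define \<epsilon> where "\<epsilon> = (\<beta> 0)\<^sup>2 / 2 / (K\<^sup>2 + 1)"
  have K1: "K\<^sup>2 + 1 > 0" by (simp add: add_nonneg_pos)
  have "\<epsilon> > 0" using weights_pos[of 0] K1 by (simp add: \<epsilon>_def)
  then obtain F where F: "finite F" "restrict_series (- F) f \<in> carrier (H2 \<beta>)"
      "(hnorm (H2 \<beta>) (restrict_series (- F) f))\<^sup>2 \<le> \<epsilon>"
    using finite_restriction_approximates[OF f(1)] by metis
  have "\<Gamma> f = \<Gamma> (restrict_series F f) + \<Gamma> (restrict_series (- F) f)"
    by (subst restrict_series_split[of f F])
      (rule add[OF restrict_series_finite_carrier(1)[OF F(1)] F(2)])
  then have "\<Gamma> (restrict_series (- F) f) 0 = 1"
    using finite_0[OF F(1), of f] f(2) by (metis add_0 plus_fun_apply zpow_def)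
  then have "(\<beta> 0)\<^sup>2 \<le> (hnorm (H2 \<beta>) (\<Gamma> (restrict_series (- F) f)))\<^sup>2"
    using sum_weighted_square_le[OF closed[OF F(2)], of "{0}"] by (simp add: weighted_square_def)
  also have "\<dots> \<le> K\<^sup>2 * \<epsilon>"
    using K[OF F(2)] F(3) by (meson mult_left_mono order_trans zero_le_power2)
  also have "\<dots> \<le> (K\<^sup>2 + 1) * \<epsilon>" using \<open>\<epsilon> > 0\<close> by simp
  also have "\<dots> = (\<beta> 0)\<^sup>2 / 2"
    unfolding \<epsilon>_def using K1
    by (metis less_irrefl nonzero_mult_div_cancel_left times_divide_eq_right)
  finally show False using weights_pos[of 0] by simp
qed

text \<open>
  Apply \<open>\<Gamma>\<close> to the degree \<open>n\<close> part of \<open>f\<close>. The part of degree \<open>n\<close> of the image is a nonzero multiple of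
  that of \<open>C\<^sub>u f\<close>, and is no longer than the image itself. The constant does not depend on \<open>n\<close>.
\<close>

lemma degree_bound:
  obtains C where "C \<ge> 0" "\<And>f n. (\<Sum>\<gamma> | mdegree \<gamma> = n. weighted_square \<beta> (Cu u f) \<gamma>)
    \<le> C * (\<Sum>\<gamma> | mdegree \<gamma> = n. weighted_square \<beta> f \<gamma>)"
proof -
  obtain K where K: "\<And>f. f \<in> carrier (H2 \<beta>) \<Longrightarrow> (hnorm (H2 \<beta>) (\<Gamma> f))\<^sup>2 \<le> K\<^sup>2 * (hnorm (H2 \<beta>) f)\<^sup>2"
    using bounded by blast
  have "(\<Sum>\<gamma> | mdegree \<gamma> = n. weighted_square \<beta> (Cu u f) \<gamma>)
    \<le> K\<^sup>2 / (cmod const_term)\<^sup>2 * (\<Sum>\<gamma> | mdegree \<gamma> = n. weighted_square \<beta> f \<gamma>)" for f n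
  proof -
    let ?A = "{\<gamma> :: 'd multiindex. mdegree \<gamma> = n}"
    let ?p = "restrict_series ?A f"
    have "\<Gamma> ?p \<gamma> = const_term * Cu u f \<gamma>" if "mdegree \<gamma> = n" for \<gamma>
      using that by (simp add: expand_finite finite_mdegree lowest_part_zpow Cu_apply[of u f]
          sum_distrib_left mult.left_commute)
    then have "(\<Sum>\<gamma>\<in>?A. weighted_square \<beta> (\<Gamma> ?p) \<gamma>)
        = (cmod const_term)\<^sup>2 * (\<Sum>\<gamma>\<in>?A. weighted_square \<beta> (Cu u f) \<gamma>)"
      by (simp add: weighted_square_def norm_mult power_mult_distrib sum_distrib_left mult.assoc)
    moreover have "(\<Sum>\<gamma>\<in>?A. weighted_square \<beta> (\<Gamma> ?p) \<gamma>) \<le> K\<^sup>2 * (\<Sum>\<gamma>\<in>?A. weighted_square \<beta> f \<gamma>)"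
      using sum_weighted_square_le[of "\<Gamma> ?p" \<beta> ?A] K[of ?p] closed[of ?p]
        restrict_series_finite_carrier[where F = ?A and f = f and \<beta> = \<beta>] finite_mdegree[where ?'d = 'd, of n]
      by (simp add: order_trans)
    ultimately show ?thesis using const_term_nonzero by (simp add: field_simps)
  qed
  then show thesis by (rule that[rotated]) simp
qed

end

text \<open>
  A finite set of exponents lies in the union of finitely many full degrees; on that union the
  bounds for the single degrees add up.
\<close>

lemma bounded_operator_Cu_of_degree_bound:
  fixes \<beta> :: "'d::finite multiindex \<Rightarrow> real"
  assumes "C \<ge> 0" and bound: "\<And>f n. (\<Sum>\<gamma> | mdegree \<gamma> = n. weighted_square \<beta> (Cu u f) \<gamma>)
    \<le> C * (\<Sum>\<gamma> | mdegree \<gamma> = n. weighted_square \<beta> f \<gamma>)"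
  shows "bounded_operator (H2 \<beta>) (Cu u)"
proof -
  have finite_bound: "(\<Sum>\<gamma>\<in>F. weighted_square \<beta> (Cu u f) \<gamma>) \<le> C * (hnorm (H2 \<beta>) f)\<^sup>2"
    if f: "f \<in> carrier (H2 \<beta>)" and F: "finite F" for f F
  proof -
    let ?D = "mdegree ` F"
    let ?G = "{\<gamma>. mdegree \<gamma> \<in> ?D}"
    have G_Union: "?G = (\<Union>n\<in>?D. {\<gamma>. mdegree \<gamma> = n})" by auto
    have G: "finite ?G" unfolding G_Union using F by (simp add: finite_mdegree)
    have by_degree: "(\<Sum>\<gamma>\<in>?G. h \<gamma>) = (\<Sum>n\<in>?D. \<Sum>\<gamma> | mdegree \<gamma> = n. h \<gamma>)"
      for h :: "'d multiindex \<Rightarrow> real"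
      unfolding G_Union using F by (subst sum.UNION_disjoint) (auto simp: finite_mdegree)
    have "(\<Sum>\<gamma>\<in>F. weighted_square \<beta> (Cu u f) \<gamma>) \<le> (\<Sum>\<gamma>\<in>?G. weighted_square \<beta> (Cu u f) \<gamma>)"
      by (rule sum_mono2[OF G]) (auto simp: weighted_square_nonneg)
    also have "\<dots> \<le> C * (\<Sum>\<gamma>\<in>?G. weighted_square \<beta> f \<gamma>)"
      unfolding by_degree sum_distrib_left[of C "\<lambda>n. sum _ {\<gamma>. mdegree \<gamma> = n}"]
      by (intro sum_mono bound)
    also have "\<dots> \<le> C * (hnorm (H2 \<beta>) f)\<^sup>2"
      by (intro mult_left_mono sum_weighted_square_le f G \<open>C \<ge> 0\<close>)
    finally show ?thesis .
  qed
  have closed: "Cu u f \<in> carrier (H2 \<beta>)" if f: "f \<in> carrier (H2 \<beta>)" for f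
    unfolding carrier_H2
  proof (rule nonneg_bdd_above_summable_on)
    show "bdd_above (sum (weighted_square \<beta> (Cu u f)) ` {F. F \<subseteq> UNIV \<and> finite F})"
      using finite_bound[OF f] by (auto intro!: bdd_aboveI2)
  qed (rule weighted_square_nonneg)
  have "hnorm (H2 \<beta>) (Cu u f) \<le> sqrt C * hnorm (H2 \<beta>) f" if f: "f \<in> carrier (H2 \<beta>)" for f
  proof (rule power2_le_imp_le)
    have "(hnorm (H2 \<beta>) (Cu u f))\<^sup>2 \<le> C * (hnorm (H2 \<beta>) f)\<^sup>2"
      unfolding hnorm_H2_square[OF closed[OF f]]
      using closed[OF f] finite_bound[OF f] by (intro infsum_le_finite_sums) (auto simp: carrier_H2)
    then show "(hnorm (H2 \<beta>) (Cu u f))\<^sup>2 \<le> (sqrt C * hnorm (H2 \<beta>) f)\<^sup>2"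
      using \<open>C \<ge> 0\<close> by (simp add: power_mult_distrib)
    show "0 \<le> sqrt C * hnorm (H2 \<beta>) f"
      using \<open>C \<ge> 0\<close> hnorm_H2_nonneg[OF f] by simp
  qed
  moreover have "Cu u (f + g) = Cu u f + Cu u g" "Cu u (\<lambda>\<gamma>. c * f \<gamma>) = (\<lambda>\<gamma>. c * Cu u f \<gamma>)" for f g c
    by (auto simp: Cu_def distrib_right sum.distrib sum_distrib_left mult.assoc)
  ultimately show ?thesis
    using closed by (auto simp: bounded_operator_def scale_H2)
qed

theorem proposition3p3:
  fixes \<beta> :: "'d::finite multiindex \<Rightarrow> real"
  assumes "\<And>\<alpha>. \<beta> \<alpha> > 0"
    and "\<And>j. bounded_operator (H2 \<beta>) (Mz j)"
  shows "weakly_homogeneous (H2 \<beta>) (Mz :: 'd \<Rightarrow> 'd power_series \<Rightarrow> 'd power_series) \<longleftrightarrow>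
    (\<forall>u\<in>unitary_group. bounded_operator (H2 \<beta>) (Cu u))"
proof (intro iffI ballI)
  fix u :: "complex ^ 'd ^ 'd"
  assume "weakly_homogeneous (H2 \<beta>) (Mz :: 'd \<Rightarrow> _)" and "u \<in> unitary_group"
  then obtain \<Gamma> where "bounded_invertible (H2 \<beta>) \<Gamma>"
      "\<And>j f. f \<in> carrier (H2 \<beta>) \<Longrightarrow> \<Gamma> (Mz j f) = act_tuple (H2 \<beta>) u Mz j (\<Gamma> f)"
    unfolding weakly_homogeneous_def by blast
  with assms(1) interpret intertwiner \<beta> u \<Gamma> by unfold_locales
  show "bounded_operator (H2 \<beta>) (Cu u)"
    using degree_bound bounded_operator_Cu_of_degree_bound by metis
next
  assume "\<forall>u\<in>unitary_group. bounded_operator (H2 \<beta>) (Cu u)"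
  then show "weakly_homogeneous (H2 \<beta>) (Mz :: 'd \<Rightarrow> _)"
    by (intro bounded_Cu_imp_weakly_homogeneous assms(2)) blast
qed

end
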